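(* Let $n$ be a non-negative integer, let $\mathcal{X}=\{X_\alpha\mid\alpha\in I\}$ be a metric family, where $I$ is a countable indexing set, and let $\mathfrak{C}$ be a collection of metric families that is closed under coarse embeddings. Then each of the following Conditions (A) and (B) is equivalent to $\mathcal{X}$ being $n$-decomposable over $\mathfrak{C}$. (A) For every $d>0$ there exists a cover $\mathcal{V}_\alpha$ of $X_\alpha$, for each $\alpha\in I$, such that: (i) the $d$-multiplicity of $\mathcal{V}_\alpha$ is at most $n+1$ for every $\alpha\in I$; and (ii) $\bigcup_{\alpha\in I}\mathcal{V}_\alpha$ is a metric family in $\mathfrak{C}$. (B) For every $\lambda>0$ there exists a cover $\mathcal{U}_\alpha$ of $X_\alpha$, for each $\alpha\in I$, such that: (i) the multiplicity of $\mathcal{U}_\alpha$ is at most $n+1$ for every $\alpha\in I$; (ii) the Lebesgue number satisfies $L(\mathcal{U}_\alpha)\ge\lambda$ for every $\alpha\in I$; and (iii) $\bigcup_{\alpha\in I}\mathcal{U}_\alpha$ is a metric family in $\mathfrak{C}$.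
   Context: A metric family is a (countable) collection of metric spaces. A cover of a metric space $X$ is viewed as a metric family, each element carrying the subspace metric from $X$. Decomposition: Let $r>0$ and let $n$ be a non-negative integer. A metric family $\mathcal{X}$ is $(r,n)$-decomposable over a metric family $\mathcal{Y}$ if every $X\in\mathcal{X}$ can be written as $X=X_0\cup X_1\cup\cdots\cup X_n$ such that each $X_i$ is an $r$-disjoint union $X_i=\bigsqcup_j X_{ij}$ with each $X_{ij}$ in $\mathcal{Y}$ (subsets carry the subspace metric). Here $r$-disjoint means $d(U,V)>r$ for any two distinct members $U\neq V$ of the union. If $\mathfrak{C}$ is a collection of metric families, $\mathcal{X}$ is $n$-decomposable over $\mathfrak{C}$ if for every $r>0$ it is $(r,n)$-decomposable over some metric family $\mathcal{Y}$ in $\mathfrak{C}$. Coarse embeddings: A map of metric families $F:\mathcal{X}\to\mathcal{Y}$ is a collection of functions $f:X\to Y$, with $X\in\mathcal{X}$ and $Y\in\mathcal{Y}$, such that every $X\in\mathcal{X}$ is the domain of at least one $f$ in $F$. It is a coarse embedding if there exist non-decreasing functions $\delta,\rho:[0,\infty)\to[0,\infty)$ with $\lim_{t\to\infty}\delta(t)=\infty=\lim_{t\to\infty}\rho(t)$ such that for every $f:X\to Y$ in $F$ and all $x,y\in X$, $\delta(d_X(x,y))\le d_Y(f(x),f(y))\le\rho(d_X(x,y))$. A collection $\mathfrak{C}$ of metric families is closed under coarse embeddings if every metric family that coarsely embeds into a metric family in $\mathfrak{C}$ is also in $\mathfrak{C}$. Covers: the multiplicity of a cover $\mathcal{U}$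 of a metric space $X$ is the largest integer $m$ such that every point of $X$ is contained in at most $m$ elements of $\mathcal{U}$ (so "multiplicity at most $m$" means that every point lies in at most $m$ elements of $\mathcal{U}$). For $d>0$, the $d$-multiplicity of $\mathcal{U}$ is at most $m$ if every open ball $B_d(x)$ of radius $d$ in $X$ meets at most $m$ elements of $\mathcal{U}$. The Lebesgue number $L(\mathcal{U})$ is at least $\lambda>0$ if every open ball $B_\lambda(x)$ in $X$ is contained in some element of $\mathcal{U}$. *)

theory Defs
  imports "HOL-Analysis.Analysis"
begin

definition metric_family :: "'a metric set \<Rightarrow> bool" where
  "metric_family \<X> \<longleftrightarrow> countable \<X>"

(* An element of type 'a metric also records distance values outside its carrier;
   same_metric_space identifies two elements that differ only there. *)
definition same_metric_space :: "'a metric \<Rightarrow> 'a metric \<Rightarrow> bool" where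
  "same_metric_space M N \<longleftrightarrow>
     mspace M = mspace N \<and> (\<forall>x\<in>mspace M. \<forall>y\<in>mspace M. mdist M x y = mdist N x y)"

(* Extended-real valued, so that the distance to the empty set is infinity. *)
definition mset_dist :: "'a metric \<Rightarrow> 'a set \<Rightarrow> 'a set \<Rightarrow> ereal" where
  "mset_dist X U V = (INF u\<in>U. INF v\<in>V. ereal (mdist X u v))"

definition r_disjoint :: "'a metric \<Rightarrow> real \<Rightarrow> 'a set set \<Rightarrow> bool" where
  "r_disjoint X r \<D> \<longleftrightarrow> (\<forall>U\<in>\<D>. \<forall>V\<in>\<D>. U \<noteq> V \<longrightarrow> mset_dist X U V > ereal r)"

definition rn_decomposable :: "real \<Rightarrow> nat \<Rightarrow> 'a metric set \<Rightarrow> 'a metric set \<Rightarrow> bool" where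
  "rn_decomposable r n \<X> \<Y> \<longleftrightarrow>
     (\<forall>X\<in>\<X>. \<exists>P :: nat \<Rightarrow> 'a set.
        mspace X = (\<Union>i\<le>n. P i) \<and>
        (\<forall>i\<le>n. \<exists>\<D>. P i = \<Union>\<D> \<and> r_disjoint X r \<D> \<and>
           (\<forall>U\<in>\<D>. \<exists>Y\<in>\<Y>. same_metric_space Y (submetric X U))))"

definition n_decomposable :: "nat \<Rightarrow> 'a metric set \<Rightarrow> 'a metric set set \<Rightarrow> bool" where
  "n_decomposable n \<X> \<CC> \<longleftrightarrow> (\<forall>r>0. \<exists>\<Y>\<in>\<CC>. rn_decomposable r n \<X> \<Y>)"

(* A triple (X, Y, f) stands for the function f : X \<rightarrow> Y; values of f outside
   the carrier of X are irrelevant. *)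
definition family_map ::
  "'a metric set \<Rightarrow> 'b metric set \<Rightarrow> ('a metric \<times> 'b metric \<times> ('a \<Rightarrow> 'b)) set \<Rightarrow> bool" where
  "family_map \<X> \<Y> F \<longleftrightarrow>
     (\<forall>(X, Y, f)\<in>F. X \<in> \<X> \<and> Y \<in> \<Y> \<and> f \<in> mspace X \<rightarrow> mspace Y) \<and>
     (\<forall>X\<in>\<X>. \<exists>Y f. (X, Y, f) \<in> F)"

definition control_function :: "(real \<Rightarrow> real) \<Rightarrow> bool" where
  "control_function \<rho> \<longleftrightarrow>
     mono_on {0..} \<rho> \<and> \<rho> \<in> {0..} \<rightarrow> {0..} \<and> filterlim \<rho> at_top at_top"

definition coarse_embedding ::
  "'a metric set \<Rightarrow> 'b metric set \<Rightarrow> ('a metric \<times> 'b metric \<times> ('a \<Rightarrow> 'b)) set \<Rightarrow> bool" where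
  "coarse_embedding \<X> \<Y> F \<longleftrightarrow>
     family_map \<X> \<Y> F \<and>
     (\<exists>\<delta> \<rho>. control_function \<delta> \<and> control_function \<rho> \<and>
        (\<forall>(X, Y, f)\<in>F. \<forall>x\<in>mspace X. \<forall>y\<in>mspace X.
           \<delta> (mdist X x y) \<le> mdist Y (f x) (f y) \<and>
           mdist Y (f x) (f y) \<le> \<rho> (mdist X x y)))"

definition coarsely_embeds :: "'a metric set \<Rightarrow> 'b metric set \<Rightarrow> bool" where
  "coarsely_embeds \<X> \<Y> \<longleftrightarrow> (\<exists>F. coarse_embedding \<X> \<Y> F)"

definition closed_under_coarse_embeddings :: "'a metric set set \<Rightarrow> bool" where
  "closed_under_coarse_embeddings \<CC> \<longleftrightarrow>
     (\<forall>\<X>. metric_family \<X> \<longrightarrow> (\<exists>\<Y>\<in>\<CC>. coarsely_embeds \<X> \<Y>) \<longrightarrow> \<X> \<in> \<CC>)"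

definition is_cover :: "'a metric \<Rightarrow> 'a set set \<Rightarrow> bool" where
  "is_cover X \<U> \<longleftrightarrow> \<Union>\<U> = mspace X"

definition cover_family :: "'a metric \<Rightarrow> 'a set set \<Rightarrow> 'a metric set" where
  "cover_family X \<U> = submetric X ` \<U>"

(* Finiteness is explicit in the next two definitions because card is 0 on infinite sets. *)
definition multiplicity_at_most :: "'a metric \<Rightarrow> 'a set set \<Rightarrow> nat \<Rightarrow> bool" where
  "multiplicity_at_most X \<U> m \<longleftrightarrow>
     (\<forall>x\<in>mspace X. finite {U\<in>\<U>. x \<in> U} \<and> card {U\<in>\<U>. x \<in> U} \<le> m)"

definition d_multiplicity_at_most :: "real \<Rightarrow> 'a metric \<Rightarrow> 'a set set \<Rightarrow> nat \<Rightarrow> bool" where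
  "d_multiplicity_at_most d X \<U> m \<longleftrightarrow>
     (\<forall>x\<in>mspace X. finite {U\<in>\<U>. mball_of X x d \<inter> U \<noteq> {}} \<and>
                    card {U\<in>\<U>. mball_of X x d \<inter> U \<noteq> {}} \<le> m)"

definition lebesgue_number_at_least :: "'a metric \<Rightarrow> 'a set set \<Rightarrow> real \<Rightarrow> bool" where
  "lebesgue_number_at_least X \<U> l \<longleftrightarrow> (\<forall>x\<in>mspace X. \<exists>U\<in>\<U>. mball_of X x l \<subseteq> U)"

end

theory Submission
  imports Defs
begin

text \<open>
  The three conditions are shown to imply one another in a cycle: decomposability, then covers of
  small \<open>d\<close>-multiplicity, then covers of small multiplicity and large Lebesgue number, then
  decomposability again. At each step the members of the new family map into members of a family in
  \<open>\<CC>\<close> by maps that change distances by a bounded amount (identities, inclusions, or a choice of nearby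
  points), and such maps form a coarse embedding; so the closure of \<open>\<CC>\<close> applies as soon as the new
  family is countable (\<open>additively_distorted_family_in_collection\<close>).

  If \<open>X = X\<^sub>0 \<union> \<dots> \<union> X\<^sub>n\<close> with each \<open>X\<^sub>i\<close> a \<open>2d\<close>-disjoint union, then a ball of radius \<open>d\<close> meets at most
  one piece of each \<open>X\<^sub>i\<close>. All pieces together thus form a cover of \<open>d\<close>-multiplicity at most \<open>n + 1\<close>.

  If a cover has \<open>l\<close>-multiplicity at most \<open>n + 1\<close>, its \<open>l\<close>-neighbourhoods have multiplicity at most
  \<open>n + 1\<close>, because a point lies in the \<open>l\<close>-neighbourhood of \<open>V\<close> exactly if its \<open>l\<close>-ball meets \<open>V\<close>. The
  Lebesgue number of the thickened cover is at least \<open>l\<close>.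

  The substantial step goes from a cover \<open>\<U>\<close> of multiplicity at most \<open>n + 1\<close> back to a decomposition.
  The usual route maps the space to the nerve of \<open>\<U>\<close> and pulls back the open stars of the vertices of
  the barycentric subdivision; that picture can be replaced by counting. Given \<open>r\<close>, let \<open>\<epsilon> > r\<close> and let
  \<open>\<U>\<close> have Lebesgue number at least \<open>(n + 1) \<epsilon>\<close>. For a point \<open>x\<close> let \<open>S\<^sub>k(x)\<close> be the set of members of
  \<open>\<U>\<close> that contain \<open>x\<close> together with its ball of radius \<open>k \<epsilon>\<close>. In the decreasing chain
  \<open>S\<^sub>0(x) \<supseteq> \<dots> \<supseteq> S\<^bsub>n+1\<^esub>(x)\<close> the \<open>n + 2\<close> cardinalities lie between \<open>1\<close> and \<open>n + 1\<close>, so that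
  \<open>S\<^sub>k(x) = S\<^bsub>k+1\<^esub>(x)\<close> for some \<open>k \<le> n\<close> (\<open>stable_pieces_cover\<close>). Collect in one piece the points for which
  this common value is \<open>S\<close>. Such a piece is contained in every member of \<open>S\<close>. The gap between the two
  depths forces pieces of distinct labels of the same cardinality to be at distance at least \<open>\<epsilon>\<close>
  (\<open>stable_pieces_far_apart\<close>), so sorting the pieces by the \<open>n + 1\<close> possible cardinalities of \<open>S\<close>
  gives the decomposition.
\<close>

section \<open>Families at bounded distance from a member of the collection\<close>

text \<open>
  Maps that change distances by at most \<open>c\<close> are coarse embeddings with the control functions
  \<open>max 0 (t - c)\<close> and \<open>t + c\<close>, the same for all members of the family.
\<close>

lemma additively_distorted_family_in_collection:
  assumes "closed_under_coarse_embeddings \<CC>" and "\<Y> \<in> \<CC>" and "countable \<X>" and "c \<ge> 0"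
    and near: "\<And>M. M \<in> \<X> \<Longrightarrow> \<exists>N\<in>\<Y>. \<exists>f. f \<in> mspace M \<rightarrow> mspace N \<and>
      (\<forall>x\<in>mspace M. \<forall>y\<in>mspace M. \<bar>mdist N (f x) (f y) - mdist M x y\<bar> \<le> c)"
  shows "\<X> \<in> \<CC>"
proof -
  define F where "F = {(M, N, f). M \<in> \<X> \<and> N \<in> \<Y> \<and> f \<in> mspace M \<rightarrow> mspace N \<and>
      (\<forall>x\<in>mspace M. \<forall>y\<in>mspace M. \<bar>mdist N (f x) (f y) - mdist M x y\<bar> \<le> c)}"
  have "family_map \<X> \<Y> F"
    unfolding family_map_def
  proof
    show "\<forall>(M, N, f)\<in>F. M \<in> \<X> \<and> N \<in> \<Y> \<and> f \<in> mspace M \<rightarrow> mspace N"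
      by (simp add: F_def split_beta)
    show "\<forall>M\<in>\<X>. \<exists>N f. (M, N, f) \<in> F"
      using near unfolding F_def mem_Collect_eq prod.case by blast
  qed
  moreover have "control_function (\<lambda>t. max 0 (t - c))" (is "control_function ?\<delta>")
  proof -
    have "filterlim (\<lambda>t. t - c) at_top at_top"
      using filterlim_tendsto_add_at_top[OF tendsto_const[of "- c"] filterlim_ident]
      by (simp add: algebra_simps)
    then have "filterlim ?\<delta> at_top at_top"
      by (rule filterlim_at_top_mono) simp
    then show ?thesis
      by (auto simp: control_function_def mono_on_def)
  qed
  moreover have "control_function (\<lambda>t. t + c)"
  proof -
    have "filterlim (\<lambda>t. t + c) at_top at_top"
      using filterlim_tendsto_add_at_top[OF tendsto_const[of c] filterlim_ident]
      by (simp add: algebra_simps)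
    then show ?thesis
      using \<open>c \<ge> 0\<close> by (auto simp: control_function_def mono_on_def)
  qed
  moreover have "?\<delta> (mdist M x y) \<le> mdist N (f x) (f y) \<and> mdist N (f x) (f y) \<le> mdist M x y + c"
    if "(M, N, f) \<in> F" "x \<in> mspace M" "y \<in> mspace M" for M N f x y
  proof -
    have "\<bar>mdist N (f x) (f y) - mdist M x y\<bar> \<le> c"
      using that by (simp add: F_def)
    moreover have "mdist N (f x) (f y) \<ge> 0"
      by simp
    ultimately show ?thesis
      by linarith
  qed
  ultimately have "coarsely_embeds \<X> \<Y>"
    unfolding coarsely_embeds_def coarse_embedding_def by blast
  then show ?thesis
    using assms(1-3) unfolding closed_under_coarse_embeddings_def metric_family_def by blast
qed

section \<open>From decompositions to covers of small multiplicity at scale d\<close>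

lemma r_disjointD:
  assumes "r_disjoint X r \<D>" "U \<in> \<D>" "V \<in> \<D>" "u \<in> U" "v \<in> V" "mdist X u v \<le> r"
  shows "U = V"
proof (rule ccontr)
  assume "U \<noteq> V"
  then have "ereal r < mset_dist X U V"
    using assms by (auto simp: r_disjoint_def)
  also have "\<dots> \<le> ereal (mdist X u v)"
    unfolding mset_dist_def using assms by (meson INF_lower2 order_refl)
  finally show False
    using assms by simp
qed

text \<open>
  Two points of a ball of radius \<open>d\<close> are at distance less than \<open>2d\<close>, so the ball meets at most one
  member of each of the \<open>n + 1\<close> disjoint unions.
\<close>

lemma d_multiplicity_union_r_disjoint:
  fixes n :: nat
  assumes disj: "\<And>i. i \<le> n \<Longrightarrow> r_disjoint X (2 * d) (\<D> i)"
  shows "d_multiplicity_at_most d X (\<Union>i\<le>n. \<D> i) (n + 1)"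
  unfolding d_multiplicity_at_most_def
proof (intro ballI)
  fix x assume "x \<in> mspace X"
  let ?M = "\<lambda>i. {U \<in> \<D> i. mball_of X x d \<inter> U \<noteq> {}}"
  have one: "finite (?M i) \<and> card (?M i) \<le> 1" if "i \<le> n" for i
  proof -
    have unique: "U = V" if UV: "U \<in> ?M i" "V \<in> ?M i" for U V
    proof -
      obtain u v where uv: "u \<in> U" "v \<in> V" "u \<in> mspace X" "v \<in> mspace X"
          "mdist X x u < d" "mdist X x v < d"
        using UV by fastforce
      have "mdist X u v \<le> mdist X u x + mdist X x v"
        using uv \<open>x \<in> mspace X\<close> by (intro mdist_triangle) auto
      then have "mdist X u v \<le> 2 * d"
        using uv mdist_commute[of X u x] by linarith
      then show ?thesis
        using r_disjointD[OF disj[OF \<open>i \<le> n\<close>]] UV uv by blast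
    qed
    show ?thesis
    proof (cases "?M i = {}")
      case False
      then obtain U where U: "U \<in> ?M i"
        by (simp only: ex_in_conv[symmetric]) blast
      have "?M i \<subseteq> {U}"
        using unique[OF _ U] by (intro subsetI) (simp only: singleton_iff)
      then show ?thesis
        using finite_subset[of "?M i" "{U}"] card_mono[of "{U}" "?M i"] by simp
    next
      case True
      then show ?thesis
        by (simp only: card.empty finite.emptyI zero_le simp_thms)
    qed
  qed
  have eq: "{U \<in> (\<Union>i\<le>n. \<D> i). mball_of X x d \<inter> U \<noteq> {}} = (\<Union>i\<le>n. ?M i)"
    by blast
  have "card (\<Union>i\<le>n. ?M i) \<le> (\<Sum>i\<le>n. card (?M i))"
    by (rule card_UN_le) simp
  also have "\<dots> \<le> (\<Sum>i\<le>n. 1)"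
    using one by (intro sum_mono) auto
  finally have "card (\<Union>i\<le>n. ?M i) \<le> n + 1"
    by simp
  moreover have "finite (\<Union>i\<le>n. ?M i)"
    using one by auto
  ultimately show "finite {U \<in> (\<Union>i\<le>n. \<D> i). mball_of X x d \<inter> U \<noteq> {}} \<and>
      card {U \<in> (\<Union>i\<le>n. \<D> i). mball_of X x d \<inter> U \<noteq> {}} \<le> n + 1"
    unfolding eq by blast
qed

text \<open>
  The pieces at scale \<open>2d\<close> form the cover. Each is the carrier of a member of the countable family
  \<open>\<Y>\<close> over which the spaces decompose, so that only countably many subspaces arise; the identity maps
  then put this family in \<open>\<CC>\<close>.
\<close>

lemma d_multiplicity_covers_of_n_decomposable:
  fixes X :: "'i \<Rightarrow> 'a metric"
  assumes "countable I" and \<CC>: "\<forall>\<Y>\<in>\<CC>. metric_family \<Y>" "closed_under_coarse_embeddings \<CC>"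
    and dec: "n_decomposable n (X ` I) \<CC>" and "d > 0"
  obtains \<V> :: "'i \<Rightarrow> 'a set set"
  where "\<And>\<alpha>. \<alpha> \<in> I \<Longrightarrow> is_cover (X \<alpha>) (\<V> \<alpha>)"
    and "\<And>\<alpha>. \<alpha> \<in> I \<Longrightarrow> d_multiplicity_at_most d (X \<alpha>) (\<V> \<alpha>) (n + 1)"
    and "(\<Union>\<alpha>\<in>I. cover_family (X \<alpha>) (\<V> \<alpha>)) \<in> \<CC>"
proof -
  obtain \<Y> where \<Y>: "\<Y> \<in> \<CC>" "rn_decomposable (2 * d) n (X ` I) \<Y>"
    using dec \<open>d > 0\<close> unfolding n_decomposable_def by (meson mult_pos_pos zero_less_numeral)
  define decomposes where "decomposes \<alpha> \<D> \<longleftrightarrow> r_disjoint (X \<alpha>) (2 * d) \<D> \<and>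
      (\<forall>U\<in>\<D>. \<exists>Y\<in>\<Y>. same_metric_space Y (submetric (X \<alpha>) U))" for \<alpha> \<D>
  have "\<exists>\<D>. mspace (X \<alpha>) = (\<Union>i\<le>n. \<Union>(\<D> i)) \<and> (\<forall>i\<le>n. decomposes \<alpha> (\<D> i))" if "\<alpha> \<in> I" for \<alpha>
  proof -
    have "\<exists>P. mspace (X \<alpha>) = (\<Union>i\<le>n. P i) \<and>
        (\<forall>i\<le>n. \<exists>\<D>. P i = \<Union>\<D> \<and> decomposes \<alpha> \<D>)"
      using \<Y>(2) \<open>\<alpha> \<in> I\<close> unfolding rn_decomposable_def decomposes_def
      by (rule bspec[OF _ imageI])
    then obtain P where P: "mspace (X \<alpha>) = (\<Union>i\<le>n. P i)"
        "\<forall>i\<le>n. \<exists>\<D>. P i = \<Union>\<D> \<and> decomposes \<alpha> \<D>"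
      by (elim exE conjE)
    from P(2) obtain \<D> where "\<forall>i\<le>n. P i = \<Union>(\<D> i) \<and> decomposes \<alpha> (\<D> i)"
      by metis
    with P(1) show ?thesis
      by (intro exI[of _ \<D>]) auto
  qed
  then obtain \<D> where cov: "\<And>\<alpha>. \<alpha> \<in> I \<Longrightarrow> mspace (X \<alpha>) = (\<Union>i\<le>n. \<Union>(\<D> \<alpha> i))"
    and D: "\<And>\<alpha> i. \<alpha> \<in> I \<Longrightarrow> i \<le> n \<Longrightarrow> decomposes \<alpha> (\<D> \<alpha> i)"
    by metis
  have disj: "r_disjoint (X \<alpha>) (2 * d) (\<D> \<alpha> i)" if "\<alpha> \<in> I" "i \<le> n" for \<alpha> i
    using D[OF that] by (simp add: decomposes_def)
  have same: "\<exists>Y\<in>\<Y>. same_metric_space Y (submetric (X \<alpha>) U)"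
    if "\<alpha> \<in> I" "i \<le> n" "U \<in> \<D> \<alpha> i" for \<alpha> i U
    using D[OF that(1,2)] that(3) by (simp add: decomposes_def)
  define \<V> where "\<V> \<alpha> = (\<Union>i\<le>n. \<D> \<alpha> i)" for \<alpha>
  have sub: "U \<subseteq> mspace (X \<alpha>)" if "\<alpha> \<in> I" "U \<in> \<V> \<alpha>" for \<alpha> U
    using that cov[of \<alpha>] unfolding \<V>_def by blast
  have carrier: "\<V> \<alpha> \<subseteq> mspace ` \<Y>" if "\<alpha> \<in> I" for \<alpha>
  proof
    fix U assume "U \<in> \<V> \<alpha>"
    then obtain Y where "Y \<in> \<Y>" "same_metric_space Y (submetric (X \<alpha>) U)"
      using same \<open>\<alpha> \<in> I\<close> unfolding \<V>_def by blast
    then have "U = mspace Y"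
      using sub[OF \<open>\<alpha> \<in> I\<close> \<open>U \<in> \<V> \<alpha>\<close>] by (simp add: same_metric_space_def Int_absorb2)
    with \<open>Y \<in> \<Y>\<close> show "U \<in> mspace ` \<Y>"
      by blast
  qed
  have "countable \<Y>"
    using \<CC>(1) \<Y>(1) by (simp add: metric_family_def)
  then have "countable (\<V> \<alpha>)" if "\<alpha> \<in> I" for \<alpha>
    using carrier[OF that] by (meson countable_image countable_subset)
  then have "countable (\<Union>\<alpha>\<in>I. cover_family (X \<alpha>) (\<V> \<alpha>))"
    using \<open>countable I\<close> by (simp add: cover_family_def)
  then have "(\<Union>\<alpha>\<in>I. cover_family (X \<alpha>) (\<V> \<alpha>)) \<in> \<CC>"
  proof (rule additively_distorted_family_in_collection[OF \<CC>(2) \<Y>(1), where c = 0])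
    fix M assume "M \<in> (\<Union>\<alpha>\<in>I. cover_family (X \<alpha>) (\<V> \<alpha>))"
    then obtain \<alpha> i U where "\<alpha> \<in> I" "i \<le> n" "U \<in> \<D> \<alpha> i" and M: "M = submetric (X \<alpha>) U"
      by (auto simp: cover_family_def \<V>_def)
    then obtain Y where "Y \<in> \<Y>" "same_metric_space Y M"
      using same by blast
    then show "\<exists>N\<in>\<Y>. \<exists>f. f \<in> mspace M \<rightarrow> mspace N \<and>
      (\<forall>x\<in>mspace M. \<forall>y\<in>mspace M. \<bar>mdist N (f x) (f y) - mdist M x y\<bar> \<le> 0)"
      unfolding same_metric_space_def by (intro bexI[of _ Y] exI[of _ "\<lambda>x. x"]) auto
  qed simp
  moreover have "is_cover (X \<alpha>) (\<V> \<alpha>)" if "\<alpha> \<in> I" for \<alpha>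
    using cov[OF that] by (auto simp: is_cover_def \<V>_def)
  moreover have "d_multiplicity_at_most d (X \<alpha>) (\<V> \<alpha>) (n + 1)" if "\<alpha> \<in> I" for \<alpha>
    unfolding \<V>_def by (rule d_multiplicity_union_r_disjoint) (rule disj[OF that])
  ultimately show ?thesis
    using that by blast
qed

section \<open>Thickening a cover\<close>

definition neighbourhood :: "'a metric \<Rightarrow> real \<Rightarrow> 'a set \<Rightarrow> 'a set" where
  "neighbourhood X l V = {x \<in> mspace X. mball_of X x l \<inter> V \<noteq> {}}"

lemma subset_neighbourhood:
  assumes "V \<subseteq> mspace X" and "l > 0"
  shows "V \<subseteq> neighbourhood X l V"
proof
  fix x assume "x \<in> V"
  with assms have "x \<in> mspace X"
    by blast
  moreover from this have "mdist X x x = 0"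
    by simp
  ultimately have "x \<in> mball_of X x l"
    using \<open>l > 0\<close> by (simp only: in_mball_of)
  with \<open>x \<in> V\<close> \<open>x \<in> mspace X\<close> show "x \<in> neighbourhood X l V"
    unfolding neighbourhood_def by blast
qed

lemma is_cover_neighbourhoods:
  assumes "is_cover X \<V>" and "l > 0"
  shows "is_cover X (neighbourhood X l ` \<V>)"
  unfolding is_cover_def
proof
  show "\<Union>(neighbourhood X l ` \<V>) \<subseteq> mspace X"
    unfolding neighbourhood_def by blast
  have "V \<subseteq> neighbourhood X l V" if "V \<in> \<V>" for V
    using assms that by (intro subset_neighbourhood) (auto simp: is_cover_def)
  then show "mspace X \<subseteq> \<Union>(neighbourhood X l ` \<V>)"
    using assms(1) unfolding is_cover_def by blast
qed

text \<open>
  The thickened sets containing \<open>x\<close> are exactly those of the members of \<open>\<V>\<close> that meet the \<open>l\<close>-ball about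
  \<open>x\<close>; distinct members may have equal neighbourhoods, which only lowers the count.
\<close>

lemma multiplicity_neighbourhoods:
  assumes "d_multiplicity_at_most l X \<V> m"
  shows "multiplicity_at_most X (neighbourhood X l ` \<V>) m"
  unfolding multiplicity_at_most_def
proof (intro ballI)
  fix x assume x: "x \<in> mspace X"
  let ?M = "{V \<in> \<V>. mball_of X x l \<inter> V \<noteq> {}}"
  have M: "finite ?M" "card ?M \<le> m"
    using assms x by (auto simp: d_multiplicity_at_most_def)
  have eq: "{U \<in> neighbourhood X l ` \<V>. x \<in> U} = neighbourhood X l ` ?M"
    using x by (auto simp: neighbourhood_def)
  show "finite {U \<in> neighbourhood X l ` \<V>. x \<in> U} \<and> card {U \<in> neighbourhood X l ` \<V>. x \<in> U} \<le> m"
    unfolding eq using M card_image_le[OF M(1), of "neighbourhood X l"] by auto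
qed

lemma lebesgue_number_neighbourhoods:
  assumes "is_cover X \<V>"
  shows "lebesgue_number_at_least X (neighbourhood X l ` \<V>) l"
  unfolding lebesgue_number_at_least_def
proof
  fix x assume "x \<in> mspace X"
  then obtain V where V: "V \<in> \<V>" "x \<in> V"
    using assms by (auto simp: is_cover_def)
  have "mball_of X x l \<subseteq> neighbourhood X l V"
    using V \<open>x \<in> mspace X\<close> by (auto simp: neighbourhood_def in_mball_of mdist_commute)
  with V show "\<exists>U\<in>neighbourhood X l ` \<V>. mball_of X x l \<subseteq> U"
    by blast
qed

text \<open>
  Send each point to a point of \<open>V\<close> at distance less than \<open>l\<close>; each of two points moves by less
  than \<open>l\<close>.
\<close>

lemma projection_of_neighbourhood:
  obtains f where "f \<in> neighbourhood X l V \<rightarrow> V \<inter> mspace X"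
    and "\<And>x y. x \<in> neighbourhood X l V \<Longrightarrow> y \<in> neighbourhood X l V \<Longrightarrow>
      \<bar>mdist X (f x) (f y) - mdist X x y\<bar> \<le> 2 * l"
proof -
  have "\<exists>v. v \<in> V \<and> v \<in> mspace X \<and> mdist X x v < l" if "x \<in> neighbourhood X l V" for x
    using that by (auto simp: neighbourhood_def in_mball_of)
  then obtain f where f: "\<And>x. x \<in> neighbourhood X l V \<Longrightarrow>
      f x \<in> V \<and> f x \<in> mspace X \<and> mdist X x (f x) < l"
    by metis
  have "\<bar>mdist X (f x) (f y) - mdist X x y\<bar> \<le> 2 * l"
    if "x \<in> neighbourhood X l V" "y \<in> neighbourhood X l V" for x y
  proof -
    have X: "x \<in> mspace X" "y \<in> mspace X"
      using that by (auto simp: neighbourhood_def)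
    have "mdist X (f x) (f y) \<le> mdist X (f x) x + mdist X x (f y)"
         "mdist X x (f y) \<le> mdist X x y + mdist X y (f y)"
         "mdist X x y \<le> mdist X x (f x) + mdist X (f x) y"
         "mdist X (f x) y \<le> mdist X (f x) (f y) + mdist X (f y) y"
      using f that X by (auto intro!: mdist_triangle)
    then show ?thesis
      using f[OF that(1)] f[OF that(2)] mdist_commute[of X x "f x"] mdist_commute[of X y "f y"]
      by linarith
  qed
  then show ?thesis
    using that f by blast
qed

lemma neighbourhood_family_in_collection:
  assumes "countable I" and \<CC>: "closed_under_coarse_embeddings \<CC>"
    and "(\<Union>\<alpha>\<in>I. cover_family (X \<alpha>) (\<V> \<alpha>)) \<in> \<CC>" (is "?\<Y> \<in> _")
    and "\<And>\<alpha>. \<alpha> \<in> I \<Longrightarrow> countable (\<V> \<alpha>)" and "l > 0"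
  shows "(\<Union>\<alpha>\<in>I. cover_family (X \<alpha>) (neighbourhood (X \<alpha>) l ` \<V> \<alpha>)) \<in> \<CC>"
proof (rule additively_distorted_family_in_collection[OF \<CC> assms(3), where c = "2 * l"])
  show "countable (\<Union>\<alpha>\<in>I. cover_family (X \<alpha>) (neighbourhood (X \<alpha>) l ` \<V> \<alpha>))"
    using assms by (simp add: cover_family_def)
next
  fix M assume "M \<in> (\<Union>\<alpha>\<in>I. cover_family (X \<alpha>) (neighbourhood (X \<alpha>) l ` \<V> \<alpha>))"
  then obtain \<alpha> V where \<alpha>: "\<alpha> \<in> I" "V \<in> \<V> \<alpha>" and M: "M = submetric (X \<alpha>) (neighbourhood (X \<alpha>) l V)"
    by (auto simp: cover_family_def)
  obtain f where "f \<in> neighbourhood (X \<alpha>) l V \<rightarrow> V \<inter> mspace (X \<alpha>)"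
    "\<And>x y. x \<in> neighbourhood (X \<alpha>) l V \<Longrightarrow> y \<in> neighbourhood (X \<alpha>) l V \<Longrightarrow>
      \<bar>mdist (X \<alpha>) (f x) (f y) - mdist (X \<alpha>) x y\<bar> \<le> 2 * l"
    using projection_of_neighbourhood[where X = "X \<alpha>" and l = l and V = V] by blast
  then have "f \<in> mspace M \<rightarrow> mspace (submetric (X \<alpha>) V)" "\<forall>x\<in>mspace M. \<forall>y\<in>mspace M.
      \<bar>mdist (submetric (X \<alpha>) V) (f x) (f y) - mdist M x y\<bar> \<le> 2 * l"
    by (auto simp: M)
  moreover have "submetric (X \<alpha>) V \<in> ?\<Y>"
    using \<alpha> by (auto simp: cover_family_def)
  ultimately show "\<exists>N\<in>?\<Y>. \<exists>f. f \<in> mspace M \<rightarrow> mspace N \<and>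
      (\<forall>x\<in>mspace M. \<forall>y\<in>mspace M. \<bar>mdist N (f x) (f y) - mdist M x y\<bar> \<le> 2 * l)"
    by blast
qed (use \<open>l > 0\<close> in simp)

text \<open>
  A member of a cover can be recovered from its subspace as the carrier. Membership in \<open>\<CC>\<close>, which
  makes the family of subspaces countable, therefore makes each cover countable.
\<close>

lemma countable_cover_of_cover_family:
  assumes "countable (cover_family X \<U>)" and "is_cover X \<U>"
  shows "countable \<U>"
proof -
  have "inj_on (submetric X) \<U>"
  proof (rule inj_on_inverseI)
    fix U assume "U \<in> \<U>"
    then show "mspace (submetric X U) = U"
      using assms by (auto simp: is_cover_def)
  qed
  then show ?thesis
    using assms(1) countable_image_inj_on unfolding cover_family_def by blast
qed

section \<open>Decomposing along a cover of large Lebesgue number\<close>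

text \<open>
  The condition \<open>x \<in> U\<close> is what remains at depth \<open>0\<close>, where the open ball is empty.
\<close>

definition deep_members :: "'a metric \<Rightarrow> 'a set set \<Rightarrow> real \<Rightarrow> 'a \<Rightarrow> 'a set set" where
  "deep_members X \<U> t x = {U \<in> \<U>. x \<in> U \<and> mball_of X x t \<subseteq> U}"

text \<open>
  A point may have several stable depths \<open>k\<close>, so that pieces with different labels \<open>S\<close> may overlap; this
  can only happen for finite labels if their cardinalities differ.
\<close>

definition stable_piece :: "'a metric \<Rightarrow> 'a set set \<Rightarrow> real \<Rightarrow> nat \<Rightarrow> 'a set set \<Rightarrow> 'a set" where
  "stable_piece X \<U> \<epsilon> n S = {x \<in> mspace X.
     \<exists>k\<le>n. deep_members X \<U> (real k * \<epsilon>) x = S \<and> deep_members X \<U> (real (Suc k) * \<epsilon>) x = S}"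

lemma deep_members_antimono:
  assumes "s \<le> t" shows "deep_members X \<U> t x \<subseteq> deep_members X \<U> s x"
  using assms unfolding deep_members_def by (fastforce simp: in_mball_of)

lemma deep_members_nearby:
  assumes "x \<in> mspace X" "y \<in> mspace X" "mdist X x y < \<epsilon>" "t \<ge> 0"
  shows "deep_members X \<U> (t + \<epsilon>) x \<subseteq> deep_members X \<U> t y"
proof
  fix U assume U: "U \<in> deep_members X \<U> (t + \<epsilon>) x"
  have "z \<in> U" if "z \<in> mspace X" "mdist X y z < t" for z
  proof -
    have "mdist X x z \<le> mdist X x y + mdist X y z"
      using assms that by (intro mdist_triangle) auto
    then show ?thesis
      using U that assms by (auto simp: deep_members_def in_mball_of)
  qed
  moreover have "y \<in> U"
    using U assms by (auto simp: deep_members_def in_mball_of)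
  ultimately show "U \<in> deep_members X \<U> t y"
    using U by (auto simp: deep_members_def in_mball_of)
qed

text \<open>
  Moving by less than \<open>\<epsilon>\<close> costs at most one level of depth: the members of \<open>S\<close> have depth \<open>k + 1\<close> at
  \<open>x\<close>, hence depth \<open>k \<ge> l\<close> at \<open>y\<close>.
\<close>

lemma deep_members_subset_at_lower_depth:
  assumes "x \<in> mspace X" "y \<in> mspace X" "mdist X x y < \<epsilon>" "\<epsilon> > 0" "l \<le> k"
    and "deep_members X \<U> (real (Suc k) * \<epsilon>) x = S" "deep_members X \<U> (real l * \<epsilon>) y = T"
  shows "S \<subseteq> T"
proof -
  have "real (Suc k) * \<epsilon> = real k * \<epsilon> + \<epsilon>"
    by (simp add: algebra_simps)
  then have "S \<subseteq> deep_members X \<U> (real k * \<epsilon>) y"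
    using deep_members_nearby[OF assms(1-3), of "real k * \<epsilon>" \<U>] assms by simp
  also have "\<dots> \<subseteq> T"
    using assms by (metis deep_members_antimono less_imp_le mult_right_mono of_nat_le_iff)
  finally show ?thesis .
qed

text \<open>
  Two nearby points need not be stable at the same depth. The label of the point with the larger
  depth is contained in the other one, and equal cardinalities turn the inclusion into an equality.
\<close>

lemma stable_pieces_far_apart:
  assumes x: "x \<in> stable_piece X \<U> \<epsilon> n S" and y: "y \<in> stable_piece X \<U> \<epsilon> n T"
    and fin: "finite S" "finite T" "card S = card T" and "\<epsilon> > 0" and close: "mdist X x y < \<epsilon>"
  shows "S = T"
proof -
  obtain k where k: "deep_members X \<U> (real k * \<epsilon>) x = S"
      "deep_members X \<U> (real (Suc k) * \<epsilon>) x = S" "x \<in> mspace X"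
    using x by (auto simp: stable_piece_def)
  obtain l where l: "deep_members X \<U> (real l * \<epsilon>) y = T"
      "deep_members X \<U> (real (Suc l) * \<epsilon>) y = T" "y \<in> mspace X"
    using y by (auto simp: stable_piece_def)
  consider "l \<le> k" | "k \<le> l"
    by linarith
  then show ?thesis
  proof cases
    case 1
    then have "S \<subseteq> T"
      using deep_members_subset_at_lower_depth[OF k(3) l(3) close \<open>\<epsilon> > 0\<close> _ k(2) l(1)] by blast
    then show ?thesis
      using fin by (simp add: card_subset_eq)
  next
    case 2
    then have "T \<subseteq> S"
      using deep_members_subset_at_lower_depth[OF l(3) k(3) _ \<open>\<epsilon> > 0\<close> _ l(2) k(1)] close
      by (simp add: mdist_commute)
    then show ?thesis
      using fin by (metis card_subset_eq)
  qed
qed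

text \<open>
  Otherwise the cardinality drops at each of the \<open>n + 1\<close> steps, from at most \<open>n + 1\<close>, and the last
  set is empty.
\<close>

lemma decreasing_chain_stabilises:
  fixes A :: "nat \<Rightarrow> 'b set"
  assumes dec: "\<And>k. A (Suc k) \<subseteq> A k" and "finite (A 0)" "card (A 0) \<le> Suc n" "A (Suc n) \<noteq> {}"
  shows "\<exists>k\<le>n. A k = A (Suc k)"
proof (rule ccontr)
  assume strict: "\<not> (\<exists>k\<le>n. A k = A (Suc k))"
  have fin: "finite (A k)" for k
    by (induction k) (use assms finite_subset[OF dec] in auto)
  have "card (A k) + k \<le> Suc n" if "k \<le> Suc n" for k
    using that
  proof (induction k)
    case (Suc k)
    then have "A (Suc k) \<subset> A k"
      using strict dec[of k] by auto
    then have "card (A (Suc k)) < card (A k)"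
      using fin psubset_card_mono by blast
    then show ?case
      using Suc by simp
  qed (use assms in simp)
  from this[of "Suc n"] show False
    using fin assms(4) by simp
qed

text \<open>
  The multiplicity bounds the chain of deep members from above at depth \<open>0\<close>, and the Lebesgue number
  makes it nonempty at depth \<open>(n + 1) \<epsilon>\<close>; these are the two ends of the pigeonhole argument.
\<close>

lemma stable_pieces_cover:
  assumes mult: "multiplicity_at_most X \<U> (n + 1)"
    and leb: "lebesgue_number_at_least X \<U> (real (Suc n) * \<epsilon>)" and "\<epsilon> > 0" and x: "x \<in> mspace X"
  obtains S where "S \<subseteq> \<U>" "finite S" "S \<noteq> {}" "card S \<le> n + 1" "x \<in> stable_piece X \<U> \<epsilon> n S"
proof -
  let ?A = "\<lambda>k. deep_members X \<U> (real k * \<epsilon>) x"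
  have dec: "?A (Suc k) \<subseteq> ?A k" for k
    using \<open>\<epsilon> > 0\<close> by (intro deep_members_antimono) (simp add: mult_right_mono)
  have sub: "?A k \<subseteq> {U \<in> \<U>. x \<in> U}" for k
    by (auto simp: deep_members_def)
  have m: "finite {U \<in> \<U>. x \<in> U}" "card {U \<in> \<U>. x \<in> U} \<le> n + 1"
    using mult x by (auto simp: multiplicity_at_most_def)
  have A: "finite (?A k)" "card (?A k) \<le> n + 1" for k
    using finite_subset[OF sub m(1)] card_mono[OF m(1) sub, of k] m(2) by auto
  obtain U where "U \<in> \<U>" and ball: "mball_of X x (real (Suc n) * \<epsilon>) \<subseteq> U"
    using leb x by (auto simp: lebesgue_number_at_least_def)
  have "mdist X x x = 0"
    using x by simp
  then have "x \<in> mball_of X x (real (Suc n) * \<epsilon>)"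
    using x \<open>\<epsilon> > 0\<close> by (simp only: in_mball_of) simp
  then have "x \<in> U"
    using ball by (rule subsetD[rotated])
  then have U: "U \<in> ?A (Suc n)"
    using \<open>U \<in> \<U>\<close> ball by (simp only: deep_members_def mem_Collect_eq simp_thms)
  have "\<exists>k\<le>n. ?A k = ?A (Suc k)"
    using U A[of 0] by (intro decreasing_chain_stabilises dec) auto
  then obtain k where k: "k \<le> n" "?A k = ?A (Suc k)"
    by blast
  have "?A (Suc n) \<subseteq> ?A k"
    using \<open>\<epsilon> > 0\<close> k(1) by (intro deep_members_antimono mult_right_mono) simp_all
  then have "?A k \<noteq> {}"
    using U by blast
  moreover have "x \<in> stable_piece X \<U> \<epsilon> n (?A k)"
    using k x unfolding stable_piece_def by auto
  ultimately show ?thesis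
    using that[of "?A k"] A[of k] sub[of k] by blast
qed

lemma stable_piece_subset:
  assumes "U \<in> S" shows "stable_piece X \<U> \<epsilon> n S \<subseteq> U"
  using assms by (auto simp: stable_piece_def deep_members_def)

text \<open>
  The labels are nonempty finite subsets of the countable cover, so there are countably many pieces,
  and each piece includes isometrically into any member of its label.
\<close>

lemma n_decomposable_of_lebesgue_covers:
  fixes X :: "'i \<Rightarrow> 'a metric"
  assumes "countable I" and \<CC>: "\<forall>\<Y>\<in>\<CC>. metric_family \<Y>" "closed_under_coarse_embeddings \<CC>"
    and covers: "\<And>l. l > 0 \<Longrightarrow> \<exists>\<U> :: 'i \<Rightarrow> 'a set set.
           (\<forall>\<alpha>\<in>I. is_cover (X \<alpha>) (\<U> \<alpha>)) \<and>
           (\<forall>\<alpha>\<in>I. multiplicity_at_most (X \<alpha>) (\<U> \<alpha>) (n + 1)) \<and>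
           (\<forall>\<alpha>\<in>I. lebesgue_number_at_least (X \<alpha>) (\<U> \<alpha>) l) \<and>
           (\<Union>\<alpha>\<in>I. cover_family (X \<alpha>) (\<U> \<alpha>)) \<in> \<CC>"
  shows "n_decomposable n (X ` I) \<CC>"
  unfolding n_decomposable_def
proof (intro allI impI)
  fix r :: real assume "r > 0"
  \<comment> \<open>Disjointness asks for distances strictly above \<open>r\<close>, also for infima over infinite sets;
      this needs a scale strictly above \<open>r\<close>.\<close>
  define \<epsilon> where "\<epsilon> = r + 1"
  have "\<epsilon> > 0" "r < \<epsilon>"
    using \<open>r > 0\<close> by (auto simp: \<epsilon>_def)
  then have "real (Suc n) * \<epsilon> > 0"
    by (intro mult_pos_pos) auto
  from covers[OF this] obtain \<U> :: "'i \<Rightarrow> 'a set set" where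
        cov: "\<And>\<alpha>. \<alpha> \<in> I \<Longrightarrow> is_cover (X \<alpha>) (\<U> \<alpha>)"
    and mult: "\<And>\<alpha>. \<alpha> \<in> I \<Longrightarrow> multiplicity_at_most (X \<alpha>) (\<U> \<alpha>) (n + 1)"
    and leb: "\<And>\<alpha>. \<alpha> \<in> I \<Longrightarrow> lebesgue_number_at_least (X \<alpha>) (\<U> \<alpha>) (real (Suc n) * \<epsilon>)"
    and fam: "(\<Union>\<alpha>\<in>I. cover_family (X \<alpha>) (\<U> \<alpha>)) \<in> \<CC>" (is "?\<Z> \<in> \<CC>")
    by blast
  define labels where "labels \<alpha> = {S. finite S \<and> S \<subseteq> \<U> \<alpha> \<and> S \<noteq> {}}" for \<alpha>
  define piece where "piece \<alpha> = stable_piece (X \<alpha>) (\<U> \<alpha>) \<epsilon> n" for \<alpha>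
  define \<Y> where "\<Y> = (\<Union>\<alpha>\<in>I. (\<lambda>S. submetric (X \<alpha>) (piece \<alpha> S)) ` labels \<alpha>)"
  have "countable (labels \<alpha>)" if "\<alpha> \<in> I" for \<alpha>
  proof -
    have "countable (cover_family (X \<alpha>) (\<U> \<alpha>))"
      using \<CC>(1) fam that unfolding metric_family_def by (meson UN_upper countable_subset)
    then have "countable (\<U> \<alpha>)"
      using cov[OF that] by (rule countable_cover_of_cover_family)
    then have "countable {S. finite S \<and> S \<subseteq> \<U> \<alpha>}"
      by (rule countable_Collect_finite_subset)
    then show ?thesis
      by (rule countable_subset[rotated]) (auto simp: labels_def)
  qed
  then have "countable \<Y>"
    using \<open>countable I\<close> by (simp add: \<Y>_def)
  then have "\<Y> \<in> \<CC>"
  proof (rule additively_distorted_family_in_collection[OF \<CC>(2) fam, where c = 0])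
    fix M assume "M \<in> \<Y>"
    then obtain \<alpha> S U where \<alpha>: "\<alpha> \<in> I" and U: "U \<in> S" "U \<in> \<U> \<alpha>"
        and M: "M = submetric (X \<alpha>) (piece \<alpha> S)"
      by (fastforce simp: \<Y>_def labels_def)
    have "mspace M \<subseteq> mspace (submetric (X \<alpha>) U)"
      using stable_piece_subset[OF U(1), of "X \<alpha>" "\<U> \<alpha>" \<epsilon> n] by (auto simp: M piece_def)
    moreover have "submetric (X \<alpha>) U \<in> ?\<Z>"
      using \<alpha> U by (auto simp: cover_family_def)
    ultimately show "\<exists>N\<in>?\<Z>. \<exists>f. f \<in> mspace M \<rightarrow> mspace N \<and>
      (\<forall>x\<in>mspace M. \<forall>y\<in>mspace M. \<bar>mdist N (f x) (f y) - mdist M x y\<bar> \<le> 0)"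
      by (intro bexI[of _ "submetric (X \<alpha>) U"] exI[of _ "\<lambda>x. x"]) (auto simp: M)
  qed simp
  moreover have "rn_decomposable r n (X ` I) \<Y>"
    unfolding rn_decomposable_def
  proof
    fix Z assume "Z \<in> X ` I"
    then obtain \<alpha> where \<alpha>: "\<alpha> \<in> I" and Z: "Z = X \<alpha>"
      by blast
    \<comment> \<open>Labels have between \<open>1\<close> and \<open>n + 1\<close> elements, whence the shift by one.\<close>
    define \<D> where "\<D> i = piece \<alpha> ` {S \<in> labels \<alpha>. card S = Suc i}" for i
    have "mspace Z = (\<Union>i\<le>n. \<Union>(\<D> i))"
    proof
      show "(\<Union>i\<le>n. \<Union>(\<D> i)) \<subseteq> mspace Z"
        by (auto simp: \<D>_def piece_def stable_piece_def Z)
      show "mspace Z \<subseteq> (\<Union>i\<le>n. \<Union>(\<D> i))"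
      proof
        fix x assume "x \<in> mspace Z"
        then obtain S where S: "S \<subseteq> \<U> \<alpha>" "finite S" "S \<noteq> {}" "card S \<le> n + 1" "x \<in> piece \<alpha> S"
          using stable_pieces_cover[OF mult[OF \<alpha>] leb[OF \<alpha>] \<open>\<epsilon> > 0\<close>, of x]
          unfolding Z piece_def by blast
        then have "card S = Suc (card S - 1)"
          by (simp add: card_gt_0_iff)
        then have "piece \<alpha> S \<in> \<D> (card S - 1)"
          using S unfolding \<D>_def labels_def by blast
        moreover have "card S - 1 \<le> n"
          using S by simp
        ultimately show "x \<in> (\<Union>i\<le>n. \<Union>(\<D> i))"
          using S by blast
      qed
    qed
    moreover have "r_disjoint Z r (\<D> i)" for i
      unfolding r_disjoint_def
    proof (intro ballI impI)
      fix A B assume "A \<in> \<D> i" "B \<in> \<D> i" "A \<noteq> B"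
      then obtain S T where S: "A = piece \<alpha> S" "finite S" "card S = Suc i"
          and T: "B = piece \<alpha> T" "finite T" "card T = Suc i" and "S \<noteq> T"
        by (auto simp: \<D>_def labels_def)
      then have "\<epsilon> \<le> mdist Z x y" if "x \<in> A" "y \<in> B" for x y
        using stable_pieces_far_apart[of x "X \<alpha>" "\<U> \<alpha>" \<epsilon> n S y T] that \<open>\<epsilon> > 0\<close>
        unfolding Z piece_def by force
      then have "ereal \<epsilon> \<le> mset_dist Z A B"
        unfolding mset_dist_def by (intro INF_greatest) auto
      then show "ereal r < mset_dist Z A B"
        using \<open>r < \<epsilon>\<close> by (meson ereal_less_ereal_Ex less_ereal.simps(1) less_le_trans)
    qed
    moreover have "\<exists>Y\<in>\<Y>. same_metric_space Y (submetric Z U)" if "U \<in> \<D> i" for i U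
      using that \<alpha> unfolding Z \<D>_def \<Y>_def same_metric_space_def by blast
    ultimately have "\<forall>i\<le>n. r_disjoint Z r (\<D> i) \<and>
        (\<forall>U\<in>\<D> i. \<exists>Y\<in>\<Y>. same_metric_space Y (submetric Z U))"
        and "mspace Z = (\<Union>i\<le>n. \<Union>(\<D> i))"
      by simp_all
    then show "\<exists>P :: nat \<Rightarrow> 'a set. mspace Z = (\<Union>i\<le>n. P i) \<and>
        (\<forall>i\<le>n. \<exists>\<D>. P i = \<Union>\<D> \<and> r_disjoint Z r \<D> \<and>
           (\<forall>U\<in>\<D>. \<exists>Y\<in>\<Y>. same_metric_space Y (submetric Z U)))"
      by (intro exI[of _ "\<lambda>i. \<Union>(\<D> i)"] conjI) (assumption, metis)
  qed
  ultimately show "\<exists>\<Y>\<in>\<CC>. rn_decomposable r n (X ` I) \<Y>"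
    by blast
qed

section \<open>The equivalences\<close>

theorem proposition3p1:
  fixes n :: nat
    and I :: "'i set"
    and X :: "'i \<Rightarrow> 'a metric"
    and \<CC> :: "'a metric set set"
  assumes "countable I"
    and "\<forall>\<Y>\<in>\<CC>. metric_family \<Y>"
    and "closed_under_coarse_embeddings \<CC>"
  shows
    "(n_decomposable n (X ` I) \<CC> \<longleftrightarrow>
        (\<forall>d>0. \<exists>\<V> :: 'i \<Rightarrow> 'a set set.
           (\<forall>\<alpha>\<in>I. is_cover (X \<alpha>) (\<V> \<alpha>)) \<and>
           (\<forall>\<alpha>\<in>I. d_multiplicity_at_most d (X \<alpha>) (\<V> \<alpha>) (n + 1)) \<and>
           (\<Union>\<alpha>\<in>I. cover_family (X \<alpha>) (\<V> \<alpha>)) \<in> \<CC>)) \<and>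
     (n_decomposable n (X ` I) \<CC> \<longleftrightarrow>
        (\<forall>l>0. \<exists>\<U> :: 'i \<Rightarrow> 'a set set.
           (\<forall>\<alpha>\<in>I. is_cover (X \<alpha>) (\<U> \<alpha>)) \<and>
           (\<forall>\<alpha>\<in>I. multiplicity_at_most (X \<alpha>) (\<U> \<alpha>) (n + 1)) \<and>
           (\<forall>\<alpha>\<in>I. lebesgue_number_at_least (X \<alpha>) (\<U> \<alpha>) l) \<and>
           (\<Union>\<alpha>\<in>I. cover_family (X \<alpha>) (\<U> \<alpha>)) \<in> \<CC>))"
  (is "(?dec \<longleftrightarrow> ?A) \<and> (?dec \<longleftrightarrow> ?B)")
proof -
  have "?A" if "?dec"
  proof (intro allI impI)
    fix d :: real assume "d > 0"
    from d_multiplicity_covers_of_n_decomposable[OF assms that this]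
    show "\<exists>\<V> :: 'i \<Rightarrow> 'a set set.
           (\<forall>\<alpha>\<in>I. is_cover (X \<alpha>) (\<V> \<alpha>)) \<and>
           (\<forall>\<alpha>\<in>I. d_multiplicity_at_most d (X \<alpha>) (\<V> \<alpha>) (n + 1)) \<and>
           (\<Union>\<alpha>\<in>I. cover_family (X \<alpha>) (\<V> \<alpha>)) \<in> \<CC>"
      by metis
  qed
  moreover have "?B" if "?A"
  proof (intro allI impI)
    fix l :: real assume "l > 0"
    with that obtain \<V> :: "'i \<Rightarrow> 'a set set" where
          cov: "\<And>\<alpha>. \<alpha> \<in> I \<Longrightarrow> is_cover (X \<alpha>) (\<V> \<alpha>)"
      and mult: "\<And>\<alpha>. \<alpha> \<in> I \<Longrightarrow> d_multiplicity_at_most l (X \<alpha>) (\<V> \<alpha>) (n + 1)"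
      and fam: "(\<Union>\<alpha>\<in>I. cover_family (X \<alpha>) (\<V> \<alpha>)) \<in> \<CC>"
      by blast
    have "countable (\<V> \<alpha>)" if "\<alpha> \<in> I" for \<alpha>
    proof (rule countable_cover_of_cover_family)
      show "countable (cover_family (X \<alpha>) (\<V> \<alpha>))"
        using assms(2) fam that unfolding metric_family_def by (meson UN_upper countable_subset)
    qed (rule cov[OF that])
    then have "(\<Union>\<alpha>\<in>I. cover_family (X \<alpha>) (neighbourhood (X \<alpha>) l ` \<V> \<alpha>)) \<in> \<CC>"
      using \<open>l > 0\<close> by (intro neighbourhood_family_in_collection[OF assms(1,3) fam])
    then show "\<exists>\<U> :: 'i \<Rightarrow> 'a set set.
           (\<forall>\<alpha>\<in>I. is_cover (X \<alpha>) (\<U> \<alpha>)) \<and>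
           (\<forall>\<alpha>\<in>I. multiplicity_at_most (X \<alpha>) (\<U> \<alpha>) (n + 1)) \<and>
           (\<forall>\<alpha>\<in>I. lebesgue_number_at_least (X \<alpha>) (\<U> \<alpha>) l) \<and>
           (\<Union>\<alpha>\<in>I. cover_family (X \<alpha>) (\<U> \<alpha>)) \<in> \<CC>"
      using cov mult \<open>l > 0\<close> is_cover_neighbourhoods multiplicity_neighbourhoods
        lebesgue_number_neighbourhoods
      by (intro exI[of _ "\<lambda>\<alpha>. neighbourhood (X \<alpha>) l ` \<V> \<alpha>"]) blast
  qed
  moreover have "?dec" if "?B"
    using that by (intro n_decomposable_of_lebesgue_covers[OF assms]) blast
  ultimately show ?thesis
    by blast
qed

end
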